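(* Let $\pi$ be a partition of the set $\{1,2,\dots,n\}$ and let $k_1,\dots,k_t$ be the numbers assigned to the cycles of $\pi_{\mathrm{fat}}\circ c$ by $$k_s=(\text{number of elements of the cycle }b_s)-(\text{number of clockwise winds of }b_s).$$ Then $$\Phi(\pi)=\Sigma_{k_1,\dots,k_t}\qquad\text{in }\mathbb{C}(\widetilde{S}_\infty),$$ where $\Phi(\pi)$ is the sum, over all pushing sequences $\mathbf p\sim\pi$, of the partial permutations associated with $\mathbf p$.
   Context: Partial permutations: for a finite set $A$, a partial permutation of $A$ is a pair $(d,w)$ with $d\subseteq A$ (the support) and $w:A\to A$ a bijection with $w(x)=x$ for $x\in A\setminus d$. They form a semigroup $\widetilde{S}_A$ under $(d_1,w_1)(d_2,w_2)=(d_1\cup d_2,w_1w_2)$; $\mathbb{C}(\widetilde{S}_A)$ is its semigroup algebra. For $A\subseteq B$ there is a homomorphism $\theta^B_A:\mathbb{C}(\widetilde{S}_B)\to\mathbb{C}(\widetilde{S}_A)$ sending $(d,w)$ to $(d,w|_A)$ if $d\subseteq A$ and to $0$ otherwise. $\mathbb{C}(\widetilde{S}_\infty)$ is the projective limit of the algebras $\mathbb{C}(\widetilde{S}_{\{1,\dots,q\}})$, $q\to\infty$, along these maps. Normalized conjugacy class indicators: for integers $k_1,\dots,k_m\ge1$, in $\mathbb{C}(\widetilde{S}_A)$ put $\Sigma_{k_1,\dots,k_m}=\sum_a (a_{1,1},\dots,a_{1,k_1})\cdots(a_{m,1},\dots,a_{m,k_m})$, the sum over all injective families $a=(a_{r,s})_{1\le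 r\le m,1\le s\le k_r}$ of elements of $A$; each summand is a product of disjoint cycles regarded as a partial permutation with support $\{a_{r,s}\}$. If some $k_i=0$ then $\Sigma_{k_1,\dots,k_m}=0$. These are compatible with the maps $\theta^B_A$ and define $\Sigma_{k_1,\dots,k_m}\in\mathbb{C}(\widetilde{S}_\infty)$. Pushing sequences: let $\ast\notin A$. A sequence $\mathbf p=(p_1,\dots,p_n)$ in $A\cup\{\ast\}$ is pushing if $p_1=\ast$ and $p_l\ne p_{l+1}$ for all $1\le l\le n$, with $p_{n+1}:=p_1$. To a pushing sequence associate permutations $\sigma_{n+1},\dots,\sigma_1$ of $A\cup\{\ast\}$ and elements $a_n,\dots,a_1$ by $\sigma_{n+1}=e$, $a_{l-1}=\sigma_l(p_{l-1})$, $\sigma_{l-1}=(a_{l-1}\,\ast)\sigma_l$. Then $a_1,\dots,a_n\in A$ and $\sigma_1=(a_1\,\ast)\cdots(a_n\,\ast)$ fixes $\ast$; the partial permutation associated with $\mathbf p$ is $\sigma_1|_A$ with support $\{a_1,\dots,a_n\}$. $\mathbf p\sim\pi$ means: for all $1\le l,m\le n$, $p_l=p_m$ iff $l$ and $m$ are in the same block of $\pi$. For finite $A$, $\Phi(\pi)\in\mathbb{C}(\widetilde{S}_A)$ is the sum over pushing sequences $\mathbf p\sim\pi$ in $A\cup\{\ast\}$ of the associated partial permutations (it is $0$ if there are none); taking $A=\{1,\dots,q\}$, $q\to\infty$, this defines $\Phi(\pi)\in\mathbb{C}(\widetilde{S}_\infty)$. Fat partition and winds: for a block of $\pi$ with elements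 $x_1<\dots<x_l$ put $\pi_{\mathrm{fat}}(x_i')=x_{i+1}$ (with $x_{l+1}=x_1$); this defines a bijection $\pi_{\mathrm{fat}}:\{1',\dots,n'\}\to\{1,\dots,n\}$. Let $c:\{1,\dots,n\}\to\{1',\dots,n'\}$, $c(k)=(k-1)'$ for $k\ge2$, $c(1)=n'$. Decompose the permutation $\pi_{\mathrm{fat}}\circ c$ of $\{1,\dots,n\}$ into disjoint cycles $b_1,\dots,b_t$ (fixed points included), $b_s=(b_{s,1},\dots,b_{s,j_s})$ where $b_{s,i}\mapsto b_{s,i+1}$ and $b_{s,j_s+1}=b_{s,1}$. The number of clockwise winds of $b_s$ is the number of $1\le i\le j_s$ with $b_{s,i}\le b_{s,i+1}$. *)

theory Defs
  imports
    Complex_Main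
    "HOL-Library.Poly_Mapping"
    "HOL-Library.FuncSet"
    "HOL-Library.Disjoint_Sets"
    "HOL-Combinatorics.Cycles"
begin

section \<open>Partial permutations and their semigroup algebra\<close>

text \<open>
  A bijection of \<open>A\<close> is represented by a total function that is the identity outside \<open>A\<close>,
  so that pairs with the same support and the same bijection are equal in HOL.
\<close>

type_synonym 'a pperm = "'a set \<times> ('a \<Rightarrow> 'a)"

definition pperms :: "'a set \<Rightarrow> 'a pperm set" where
  "pperms A = {(d, w). d \<subseteq> A \<and> w permutes A \<and> (\<forall>x\<in>A - d. w x = x)}"

definition pmult :: "'a pperm \<Rightarrow> 'a pperm \<Rightarrow> 'a pperm" where
  "pmult v w = (fst v \<union> fst w, snd v \<circ> snd w)"

definition pone :: "'a pperm" where
  "pone = ({}, id)"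

definition restrict_perm :: "'a set \<Rightarrow> ('a \<Rightarrow> 'a) \<Rightarrow> 'a \<Rightarrow> 'a" where
  "restrict_perm A w = (\<lambda>x. if x \<in> A then w x else x)"

text \<open>
  The algebra of the partial permutations of \<open>A\<close> consists of the finitely supported functions
  with \<open>Poly_Mapping.keys \<subseteq> pperms A\<close>; \<open>single (d, w) 1\<close> is the basis element \<open>(d, w)\<close>.
\<close>

type_synonym 'a palg = "'a pperm \<Rightarrow>\<^sub>0 complex"

definition semigroup_algebra :: "'a set \<Rightarrow> 'a palg set" where
  "semigroup_algebra A = {f. Poly_Mapping.keys f \<subseteq> pperms A}"

text \<open>
  The map \<open>theta A\<close> restricts to the homomorphism from the algebra over \<open>B\<close> to the algebra
  over \<open>A\<close>, simultaneously for all \<open>B\<close> containing \<open>A\<close>.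
\<close>

definition theta :: "'a set \<Rightarrow> 'a palg \<Rightarrow> 'a palg" where
  "theta A f = (\<Sum>v\<in>Poly_Mapping.keys f. if fst v \<subseteq> A
     then Poly_Mapping.single (fst v, restrict_perm A (snd v)) (Poly_Mapping.lookup f v) else 0)"

lemma theta_superset:
  assumes "finite K" "Poly_Mapping.keys f \<subseteq> K"
  shows "theta A f = (\<Sum>v\<in>K. if fst v \<subseteq> A
     then Poly_Mapping.single (fst v, restrict_perm A (snd v)) (Poly_Mapping.lookup f v) else 0)"
  unfolding theta_def using assms
  by (intro sum.mono_neutral_left) (auto simp: in_keys_iff)

lemma theta_add: "theta A (f + g) = theta A f + theta A g"
proof -
  let ?K = "Poly_Mapping.keys f \<union> Poly_Mapping.keys g"
  have "Poly_Mapping.keys (f + g) \<subseteq> ?K" by (rule Poly_Mapping.keys_add)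
  then show ?thesis
    by (auto simp: theta_superset[of ?K] sum.distrib[symmetric] lookup_add single_add
        intro!: sum.cong)
qed

lemma theta_zero [simp]: "theta A 0 = 0"
  by (simp add: theta_def)

lemma theta_single_one:
  "theta A (Poly_Mapping.single v 1) =
     (if fst v \<subseteq> A then Poly_Mapping.single (fst v, restrict_perm A (snd v)) 1 else 0)"
  by (simp add: theta_def)

lemma theta_sum: "theta A (\<Sum>i\<in>I. f i) = (\<Sum>i\<in>I. theta A (f i))"
  by (induction I rule: infinite_finite_induct) (auto simp: theta_add)

lemma keys_sum_single:
  assumes "finite I" "\<And>i. i \<in> I \<Longrightarrow> g i \<in> S"
  shows "Poly_Mapping.keys (\<Sum>i\<in>I. Poly_Mapping.single (g i) (1::complex)) \<subseteq> S"
proof -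
  have "Poly_Mapping.keys (\<Sum>i\<in>I. Poly_Mapping.single (g i) (1::complex))
        \<subseteq> (\<Union>i\<in>I. Poly_Mapping.keys (Poly_Mapping.single (g i) (1::complex)))"
    by (rule Poly_Mapping.keys_sum)
  with assms(2) show ?thesis by auto
qed

lemma theta_sum_single:
  assumes "finite I" "J \<subseteq> I"
    and "\<And>i. i \<in> I \<Longrightarrow> fst (g i) \<subseteq> A \<longleftrightarrow> i \<in> J"
    and "\<And>i. i \<in> J \<Longrightarrow> (fst (g i), restrict_perm A (snd (g i))) = h i"
  shows "theta A (\<Sum>i\<in>I. Poly_Mapping.single (g i) 1) = (\<Sum>i\<in>J. Poly_Mapping.single (h i) 1)"
proof -
  have "theta A (\<Sum>i\<in>I. Poly_Mapping.single (g i) 1)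
      = (\<Sum>i\<in>I. if i \<in> J then Poly_Mapping.single (h i) 1 else 0)"
    unfolding theta_sum using assms(3,4)
    by (intro sum.cong) (auto simp: theta_single_one)
  also have "\<dots> = (\<Sum>i\<in>J. Poly_Mapping.single (h i) 1)"
    using assms(1,2) by (simp add: sum.If_cases Int_absorb1)
  finally show ?thesis .
qed

text \<open>
  The projective limit of the algebras over \<open>{1..q}\<close>. Its algebra operations, which are
  componentwise, are not needed.
\<close>

typedef palg_infinity =
  "{F :: nat \<Rightarrow> nat palg. (\<forall>q. F q \<in> semigroup_algebra {1..q}) \<and>
     (\<forall>q r. q \<le> r \<longrightarrow> theta {1..q} (F r) = F q)}"
  morphisms component Abs_palg_infinity
  by (rule exI[of _ "\<lambda>_. 0"]) (simp add: semigroup_algebra_def)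

setup_lifting type_definition_palg_infinity


section \<open>Normalized conjugacy class indicators\<close>

text \<open>
  An injective family \<open>(a\<^bsub>r,s\<^esub>)\<close> is represented by the list of its rows.
\<close>

definition inj_families :: "'a set \<Rightarrow> nat list \<Rightarrow> 'a list list set" where
  "inj_families A ks =
     {as. map length as = ks \<and> set (concat as) \<subseteq> A \<and> distinct (concat as)}"

text \<open>The library's \<open>cycle_of_list [a\<^sub>1, \<dots>, a\<^sub>k]\<close> maps \<open>a\<^sub>i\<close> to \<open>a\<^bsub>i+1\<^esub>\<close> and \<open>a\<^sub>k\<close> to \<open>a\<^sub>1\<close>.\<close>

definition product_of_cycles :: "'a list list \<Rightarrow> 'a pperm" where
  "product_of_cycles as = foldr pmult (map (\<lambda>a. (set a, cycle_of_list a)) as) pone"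

definition Sigma_alg :: "'a set \<Rightarrow> nat list \<Rightarrow> 'a palg" where
  "Sigma_alg A ks = (if 0 \<in> set ks then 0
     else \<Sum>as\<in>inj_families A ks. Poly_Mapping.single (product_of_cycles as) 1)"

lemma finite_inj_families:
  assumes "finite A"
  shows "finite (inj_families A ks)"
proof (rule finite_subset)
  let ?L = "{a. set a \<subseteq> A \<and> length a \<le> sum_list ks}"
  show "inj_families A ks \<subseteq> {as. set as \<subseteq> ?L \<and> length as = length ks}"
    unfolding inj_families_def by (auto intro: member_le_sum_list)
  show "finite {as. set as \<subseteq> ?L \<and> length as = length ks}"
    using assms by (intro finite_lists_length_eq finite_lists_length_le)
qed

lemma product_of_cycles_Nil [simp]: "product_of_cycles [] = ({}, id)"
  by (simp add: product_of_cycles_def pone_def)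

lemma product_of_cycles_Cons [simp]:
  "product_of_cycles (a # as) =
     (set a \<union> fst (product_of_cycles as), cycle_of_list a \<circ> snd (product_of_cycles as))"
  by (simp add: product_of_cycles_def pmult_def)

lemma fst_product_of_cycles: "fst (product_of_cycles as) = set (concat as)"
  by (induction as) auto

lemma product_of_cycles_permutes: "snd (product_of_cycles as) permutes set (concat as)"
proof (induction as)
  case Nil
  then show ?case by (simp add: permutes_def)
next
  case (Cons a as)
  have "cycle_of_list a permutes set (concat (a # as))"
    by (rule permutes_subset[OF cycle_permutes]) auto
  moreover have "snd (product_of_cycles as) permutes set (concat (a # as))"
    by (rule permutes_subset[OF Cons.IH]) auto
  ultimately show ?case
    unfolding product_of_cycles_Cons snd_conv by (intro permutes_compose)
qed

lemma product_of_cycles_in_pperms: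
  assumes "set (concat as) \<subseteq> A"
  shows "product_of_cycles as \<in> pperms A"
proof -
  note p = product_of_cycles_permutes[of as]
  have "product_of_cycles as = (set (concat as), snd (product_of_cycles as))"
    using fst_product_of_cycles[of as] by (metis prod.collapse)
  moreover have "(set (concat as), snd (product_of_cycles as)) \<in> pperms A"
    unfolding pperms_def using assms permutes_subset[OF p assms] permutes_not_in[OF p] by auto
  ultimately show ?thesis by simp
qed

lemma Sigma_alg_in:
  assumes "finite A"
  shows "Sigma_alg A ks \<in> semigroup_algebra A"
proof -
  have "Poly_Mapping.keys (\<Sum>as\<in>inj_families A ks. Poly_Mapping.single (product_of_cycles as) (1 :: complex))
      \<subseteq> pperms A"
    by (rule keys_sum_single[OF finite_inj_families[OF assms]])
      (rule product_of_cycles_in_pperms, simp add: inj_families_def)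
  then show ?thesis by (simp add: Sigma_alg_def semigroup_algebra_def)
qed

lemma theta_Sigma_alg:
  assumes "finite B" "A \<subseteq> B"
  shows "theta A (Sigma_alg B ks) = Sigma_alg A ks"
proof (cases "0 \<in> set ks")
  case False
  have "(fst (product_of_cycles as), restrict_perm A (snd (product_of_cycles as)))
      = product_of_cycles as" if "as \<in> inj_families A ks" for as
  proof -
    have "snd (product_of_cycles as) permutes A"
      using that permutes_subset[OF product_of_cycles_permutes]
      by (auto simp: inj_families_def simp del: set_concat)
    then have "restrict_perm A (snd (product_of_cycles as)) = snd (product_of_cycles as)"
      by (auto simp: restrict_perm_def permutes_def)
    then show ?thesis by simp
  qed
  then have "theta A (\<Sum>as\<in>inj_families B ks. Poly_Mapping.single (product_of_cycles as) 1)
      = (\<Sum>as\<in>inj_families A ks. Poly_Mapping.single (product_of_cycles as) 1)"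
    using assms
    by (intro theta_sum_single finite_inj_families)
      (auto simp: fst_product_of_cycles inj_families_def simp del: set_concat)
  with False show ?thesis by (simp add: Sigma_alg_def)
qed (simp add: Sigma_alg_def)

lift_definition Sigma_inf :: "nat list \<Rightarrow> palg_infinity" is "\<lambda>ks q. Sigma_alg {1..q} ks"
  by (auto simp: Sigma_alg_in theta_Sigma_alg)


section \<open>Pushing sequences\<close>

text \<open>
  The set \<open>A \<union> {\<ast>}\<close> is \<open>insert None (Some ` A)\<close>, with \<open>\<ast>\<close> rendered as \<open>None\<close>.
\<close>

definition pushing :: "'a set \<Rightarrow> nat \<Rightarrow> (nat \<Rightarrow> 'a option) \<Rightarrow> bool" where
  "pushing A n p \<longleftrightarrow> p \<in> {1..n} \<rightarrow>\<^sub>E insert None (Some ` A) \<and> p 1 = None \<and>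
     (\<forall>l\<in>{1..n}. p l \<noteq> p (if l = n then 1 else l + 1))"

text \<open>
  \<open>push_sigma n p l\<close> is \<open>\<sigma>\<^sub>l\<close> for \<open>1 \<le> l \<le> n + 1\<close>, and \<open>push_elem n p l\<close> is \<open>a\<^sub>l\<close> for \<open>1 \<le> l \<le> n\<close>.
\<close>

function push_sigma :: "nat \<Rightarrow> (nat \<Rightarrow> 'a option) \<Rightarrow> nat \<Rightarrow> 'a option \<Rightarrow> 'a option" where
  "push_sigma n p l = (if l > n then id
     else transpose (push_sigma n p (l + 1) (p l)) None \<circ> push_sigma n p (l + 1))"
  by auto
termination
  by (relation "measure (\<lambda>(n, p, l). n + 1 - l)") auto

declare push_sigma.simps [simp del]

definition push_elem :: "nat \<Rightarrow> (nat \<Rightarrow> 'a option) \<Rightarrow> nat \<Rightarrow> 'a option" where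
  "push_elem n p l = push_sigma n p (l + 1) (p l)"

definition assoc_pperm :: "'a set \<Rightarrow> nat \<Rightarrow> (nat \<Rightarrow> 'a option) \<Rightarrow> 'a pperm" where
  "assoc_pperm A n p =
     ({x. Some x \<in> push_elem n p ` {1..n}}, restrict_perm A (\<lambda>x. the (push_sigma n p 1 (Some x))))"

definition same_pattern :: "nat \<Rightarrow> (nat \<Rightarrow> 'a option) \<Rightarrow> nat set set \<Rightarrow> bool" where
  "same_pattern n p \<pi> \<longleftrightarrow>
     (\<forall>l\<in>{1..n}. \<forall>m\<in>{1..n}. p l = p m \<longleftrightarrow> (\<exists>B\<in>\<pi>. l \<in> B \<and> m \<in> B))"

definition Phi_alg :: "'a set \<Rightarrow> nat \<Rightarrow> nat set set \<Rightarrow> 'a palg" where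
  "Phi_alg A n \<pi> =
     (\<Sum>p | pushing A n p \<and> same_pattern n p \<pi>. Poly_Mapping.single (assoc_pperm A n p) 1)"

lemma finite_pushing:
  assumes "finite A"
  shows "finite {p. pushing A n p \<and> same_pattern n p \<pi>}"
  by (rule finite_subset[of _ "{1..n} \<rightarrow>\<^sub>E insert None (Some ` A)"])
    (use assms in \<open>auto simp: pushing_def intro!: finite_PiE\<close>)

lemma push_sigma_Suc: "n < l \<Longrightarrow> push_sigma n p l = id"
  by (subst push_sigma.simps) simp

lemma push_sigma_step:
  "l \<le> n \<Longrightarrow> push_sigma n p l = transpose (push_elem n p l) None \<circ> push_sigma n p (l + 1)"
  by (subst push_sigma.simps) (simp add: push_elem_def)

lemma push_sigma_permutes:
  assumes "\<And>m. l \<le> m \<Longrightarrow> m \<le> n \<Longrightarrow> p m \<in> insert None X"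
  shows "push_sigma n p l permutes insert None X"
  using assms
proof (induction "n + 1 - l" arbitrary: l)
  case 0
  then show ?case by (simp add: push_sigma_Suc permutes_def)
next
  case (Suc k)
  have IH: "push_sigma n p (l + 1) permutes insert None X"
    by (rule Suc.hyps) (use Suc in auto)
  have "push_elem n p l \<in> insert None X"
    unfolding push_elem_def using permutes_in_image[OF IH] Suc by simp
  then have "transpose (push_elem n p l) None permutes insert None X"
    by (intro permutes_swap_id) auto
  with IH show ?case
    using Suc.hyps by (simp add: push_sigma_step permutes_compose del: insert_iff)
qed

lemma push_sigma_permutes':
  assumes "\<And>m. l \<le> m \<Longrightarrow> m \<le> n \<Longrightarrow> push_elem n p m \<in> insert None X"
  shows "push_sigma n p l permutes insert None X"
  using assms
proof (induction "n + 1 - l" arbitrary: l)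
  case 0
  then show ?case by (simp add: push_sigma_Suc permutes_def)
next
  case (Suc k)
  have IH: "push_sigma n p (l + 1) permutes insert None X"
    by (rule Suc.hyps) (use Suc in auto)
  have "transpose (push_elem n p l) None permutes insert None X"
    by (intro permutes_swap_id) (use Suc in auto)
  with IH show ?case
    using Suc.hyps by (simp add: push_sigma_step permutes_compose del: insert_iff)
qed

lemma push_elem_in_iff:
  "(\<forall>l\<in>{1..n}. push_elem n p l \<in> insert None X) \<longleftrightarrow> (\<forall>l\<in>{1..n}. p l \<in> insert None X)"
proof
  assume a: "\<forall>l\<in>{1..n}. push_elem n p l \<in> insert None X"
  show "\<forall>l\<in>{1..n}. p l \<in> insert None X"
  proof
    fix l assume l: "l \<in> {1..n}"
    have "push_sigma n p (l + 1) permutes insert None X"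
      by (rule push_sigma_permutes') (use a l in auto)
    with a l show "p l \<in> insert None X"
      unfolding push_elem_def by (metis permutes_in_image)
  qed
next
  assume a: "\<forall>l\<in>{1..n}. p l \<in> insert None X"
  show "\<forall>l\<in>{1..n}. push_elem n p l \<in> insert None X"
  proof
    fix l assume l: "l \<in> {1..n}"
    have "push_sigma n p (l + 1) permutes insert None X"
      by (rule push_sigma_permutes) (use a l in auto)
    with a l show "push_elem n p l \<in> insert None X"
      unfolding push_elem_def by (metis permutes_in_image)
  qed
qed

lemma push_sigma_next:
  assumes "1 \<le> l" "l \<le> n" "p 1 = None"
  shows "push_sigma n p (l + 1) (p (if l = n then 1 else l + 1)) = None"
  using assms by (simp add: push_sigma_Suc) (simp add: push_sigma_step[of "Suc l"] push_elem_def)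

lemma push_elem_not_None:
  assumes "pushing A n p" "l \<in> {1..n}"
  shows "push_elem n p l \<noteq> None"
proof
  assume "push_elem n p l = None"
  then have "push_sigma n p (l + 1) (p l)
      = push_sigma n p (l + 1) (p (if l = n then 1 else l + 1))"
    using assms push_sigma_next[of l n p] by (auto simp: push_elem_def pushing_def)
  moreover have "inj (push_sigma n p (l + 1))"
    by (rule permutes_inj[OF push_sigma_permutes[where X = UNIV]]) auto
  ultimately show False
    using assms unfolding pushing_def by (blast dest: injD)
qed

lemma push_sigma_fixes_None:
  assumes "pushing A n p"
  shows "push_sigma n p 1 None = None"
  using assms push_sigma_step[of 1 n p]
  by (cases "n = 0") (auto simp: pushing_def push_sigma_Suc push_elem_def)

lemma assoc_pperm_subset_iff:
  assumes "pushing B n p"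
  shows "fst (assoc_pperm B n p) \<subseteq> A \<longleftrightarrow> (\<forall>l\<in>{1..n}. p l \<in> insert None (Some ` A))"
proof -
  have "push_elem n p l \<in> insert None (Some ` A) \<longleftrightarrow> (\<forall>x. push_elem n p l = Some x \<longrightarrow> x \<in> A)"
    if "l \<in> {1..n}" for l
    using push_elem_not_None[OF assms that] by auto
  then have "(\<forall>l\<in>{1..n}. push_elem n p l \<in> insert None (Some ` A))
      \<longleftrightarrow> (\<forall>l\<in>{1..n}. \<forall>x. push_elem n p l = Some x \<longrightarrow> x \<in> A)"
    by blast
  also have "\<dots> \<longleftrightarrow> fst (assoc_pperm B n p) \<subseteq> A"
    unfolding assoc_pperm_def fst_conv subset_iff mem_Collect_eq image_iff by metis
  finally show ?thesis
    unfolding push_elem_in_iff by (rule sym)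
qed

lemma assoc_pperm_in:
  assumes "pushing A n p"
  shows "assoc_pperm A n p \<in> pperms A"
proof -
  define s where "s = push_sigma n p 1"
  define d where "d = {x. Some x \<in> push_elem n p ` {1..n}}"
  have "\<forall>l\<in>{1..n}. p l \<in> insert None (Some ` A)"
    using assms by (auto simp: pushing_def PiE_def)
  then have dA: "d \<subseteq> A"
    using assoc_pperm_subset_iff[OF assms, of A] by (simp add: assoc_pperm_def d_def)
  have sd: "s permutes insert None (Some ` d)"
    unfolding s_def
  proof (rule push_sigma_permutes')
    fix m assume m: "1 \<le> m" "m \<le> n"
    then obtain x where x: "push_elem n p m = Some x"
      using push_elem_not_None[OF assms, of m] by auto
    have "x \<in> d"
      unfolding d_def mem_Collect_eq x[symmetric] by (rule imageI) (use m in simp)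
    then show "push_elem n p m \<in> insert None (Some ` d)"
      by (simp add: x)
  qed
  have sN: "s None = None"
    unfolding s_def by (rule push_sigma_fixes_None[OF assms])
  have injs: "inj s" by (rule permutes_inj[OF sd])
  define w where "w = restrict_perm A (\<lambda>x. the (s (Some x)))"
  have sw: "s (Some x) = Some (w x)" for x
  proof (cases "x \<in> d")
    case True
    have "s (Some x) \<noteq> None"
      using sN injD[OF injs, of "Some x" None] by auto
    then show ?thesis using True dA by (auto simp: w_def restrict_perm_def)
  next
    case False
    then have "s (Some x) = Some x"
      by (intro permutes_not_in[OF sd]) auto
    then show ?thesis by (simp add: w_def restrict_perm_def)
  qed
  have out: "w x = x" if "x \<notin> d" for x
    using sw[of x] permutes_not_in[OF sd, of "Some x"] that by auto
  have "bij w"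
  proof (rule bijI)
    show "inj w"
    proof (rule injI)
      fix x y assume "w x = w y"
      then have "s (Some x) = s (Some y)" by (simp add: sw)
      then show "x = y" using injD[OF injs] by blast
    qed
    show "surj w"
    proof (rule surjI)
      fix y
      obtain z where z: "s z = Some y"
        using permutes_surj[OF sd] by (metis surjD)
      then obtain x where "z = Some x"
        using sN by (cases z) auto
      with z have "w x = y" by (simp add: sw)
      then show "w (SOME x. w x = y) = y" by (rule someI)
    qed
  qed
  then have "w permutes d"
    using out unfolding permutes_def bij_iff by blast
  then have "w permutes A" by (rule permutes_subset[OF _ dA])
  with dA out show ?thesis
    by (auto simp: pperms_def assoc_pperm_def w_def s_def d_def)
qed

lemma Phi_alg_in:
  assumes "finite A"
  shows "Phi_alg A n \<pi> \<in> semigroup_algebra A"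
  unfolding Phi_alg_def semigroup_algebra_def mem_Collect_eq
  by (rule keys_sum_single[OF finite_pushing[OF assms]]) (simp add: assoc_pperm_in)

lemma theta_Phi_alg:
  assumes "finite B" "A \<subseteq> B"
  shows "theta A (Phi_alg B n \<pi>) = Phi_alg A n \<pi>"
  unfolding Phi_alg_def
proof (rule theta_sum_single[OF finite_pushing[OF assms(1)]], goal_cases)
  case 1
  show ?case using assms(2) by (fastforce simp: pushing_def PiE_iff)
next
  case (2 p)
  then show ?case
    by (auto simp: assoc_pperm_subset_iff pushing_def PiE_iff)
next
  case (3 p)
  show ?case using assms(2) by (auto simp: assoc_pperm_def restrict_perm_def fun_eq_iff)
qed

lift_definition Phi_inf :: "nat \<Rightarrow> nat set set \<Rightarrow> palg_infinity" is "\<lambda>n \<pi> q. Phi_alg {1..q} n \<pi>"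
  by (auto simp: Phi_alg_in theta_Phi_alg)


section \<open>Fat partition and winds\<close>

text \<open>The primed element \<open>k'\<close> is represented by \<open>k\<close> itself, in \<open>fat\<close> and in \<open>cmap\<close>.\<close>

definition fat :: "nat set set \<Rightarrow> nat \<Rightarrow> nat" where
  "fat \<pi> x = (let B = (THE B. B \<in> \<pi> \<and> x \<in> B) in
     if \<exists>y\<in>B. x < y then Min {y\<in>B. x < y} else Min B)"

definition cmap :: "nat \<Rightarrow> nat \<Rightarrow> nat" where
  "cmap n k = (if k = 1 then n else k - 1)"

definition cycle_decomposition :: "'a set \<Rightarrow> ('a \<Rightarrow> 'a) \<Rightarrow> 'a list list \<Rightarrow> bool" where
  "cycle_decomposition X f bs \<longleftrightarrow> distinct (concat bs) \<and> set (concat bs) = X \<and>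
     (\<forall>b\<in>set bs. b \<noteq> [] \<and> (\<forall>i<length b. f (b ! i) = b ! ((i + 1) mod length b)))"

definition clockwise_winds :: "nat list \<Rightarrow> nat" where
  "clockwise_winds b = card {i. i < length b \<and> b ! i \<le> b ! ((i + 1) mod length b)}"

end

theory Submission
  imports Defs
begin

text \<open>
  Read \<open>\<sigma>\<^sub>l\<close> as the placement of the elements at time \<open>l\<close>, with time running down from \<open>n + 1\<close>.
  The step \<open>l\<close> sends \<open>p\<^sub>l\<close> to \<open>\<ast>\<close> and the element \<open>p\<^bsub>l+1\<^esub>\<close>, which was at \<open>\<ast>\<close>, to \<open>a\<^sub>l\<close>, and moves
  nothing else. Put \<open>\<tau> = c \<circ> fat\<close> and call \<open>m\<close> a break if it is the last element of a block not
  containing \<open>1\<close>. Following one element through time shows that \<open>a\<^bsub>\<tau>(m)\<^esub> = a\<^sub>m\<close> unless \<open>m\<close> is a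
  break, and that \<open>a\<^sub>m = p\<^sub>m\<close> and \<open>\<sigma>\<^sub>1(a\<^sub>m) = a\<^bsub>\<tau>(m)\<^esub>\<close> if it is. Hence each cycle of \<open>\<tau>\<close>, which is
  conjugate by \<open>c\<close> to a cycle of \<open>fat \<circ> c\<close>, contributes the cycle of \<open>\<sigma>\<^sub>1\<close> through the labels \<open>p\<^sub>m\<close>
  of its breaks. These labels are arbitrary distinct elements of \<open>A\<close>, and they determine the
  sequence. On a cycle of \<open>fat \<circ> c\<close> the breaks are as many as the counterclockwise steps: the step
  into \<open>1\<close>, which is not a break, makes up for the step out of \<open>1\<close>, which is a clockwise wind. A
  cycle without breaks is a fixed point, and then two cyclically adjacent indices share a block, so
  there are no pushing sequences.
\<close>

section \<open>Cyclic lists\<close>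

text \<open>With \<open>ys\<close> the part of \<open>b\<close> after an entry,
  \<open>hd (ys @ b)\<close> is its cyclic successor. This form replaces modular indices because
  \<open>filter\<close> distributes over \<open>@\<close>.\<close>

lemma hd_drop_Suc_eq_nth_rotate1:
  assumes "i < length b"
  shows "hd (drop (Suc i) b @ b) = rotate1 b ! i"
proof (cases "Suc i < length b")
  case True
  then show ?thesis by (simp add: hd_append hd_drop_conv_nth nth_rotate1 assms)
next
  case False
  with assms have "length b = Suc i" by simp
  then show ?thesis by (cases b) (auto simp: nth_rotate1 hd_conv_nth)
qed

lemma map_eq_rotate1D:
  assumes "map f b = rotate1 b" "b = xs @ x # ys"
  shows "f x = hd (ys @ b)"
proof -
  have i: "length xs < length b" using assms(2) by simp
  have "f x = map f b ! length xs" using assms(2) by (simp add: nth_append)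
  also have "\<dots> = hd (drop (Suc (length xs)) b @ b)"
    using i assms(1) by (simp add: hd_drop_Suc_eq_nth_rotate1)
  finally show ?thesis using assms(2) by simp
qed

lemma map_eq_rotate1_image:
  assumes "map f b = rotate1 b"
  shows "f ` set b = set b"
  by (metis assms set_map set_rotate1)

text \<open>Passing from an entry without \<open>P\<close> to its successor keeps \<open>a\<close>,
  so the value at any position is that of the next entry with \<open>P\<close>. One extra copy of
  \<open>c\<close> is enough for the wrap-around.\<close>

lemma map_eq_rotate1_skip:
  assumes cyc: "map f c = rotate1 c"
    and a: "\<And>x. x \<in> set c \<Longrightarrow> \<not> P x \<Longrightarrow> a (f x) = a x"
    and P: "\<exists>x\<in>set c. P x"
    and c: "c = xs @ ys"
  shows "a (hd (ys @ c)) = a (hd (filter P (ys @ c)))"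
proof -
  have step: "a y = a (hd (zs @ c))" if "c = xs @ y # zs" "\<not> P y" for xs y zs
    using map_eq_rotate1D[OF cyc that(1)] a[of y] that by simp
  \<comment> \<open>The walk without wrap-around; it is applied to the whole of \<open>c\<close>
    once the end of the list has been passed.\<close>
  have base: "a (hd ys) = a (hd (filter P ys))"
    if "c = xs @ ys" "filter P ys \<noteq> []" for xs ys
    using that
  proof (induction ys arbitrary: xs)
    case (Cons y ys)
    show ?case
    proof (cases "P y")
      case False
      then have ne: "filter P ys \<noteq> []" using Cons.prems by simp
      then have "ys \<noteq> []" by auto
      then have "a y = a (hd ys)" using step[OF Cons.prems(1) False] by simp
      also have "\<dots> = a (hd (filter P ys))"
        by (rule Cons.IH[of "xs @ [y]"]) (use Cons.prems ne in auto)
      finally show ?thesis using False by simp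
    qed simp
  qed simp
  show ?thesis using c
  proof (induction ys arbitrary: xs)
    case Nil
    have "filter P c \<noteq> []" using P by (auto simp: filter_empty_conv)
    then show ?case using base[of "[]" c] by simp
  next
    case (Cons y ys)
    show ?case
    proof (cases "P y")
      case False
      have "a y = a (hd (ys @ c))" by (rule step[OF Cons.prems False])
      also have "\<dots> = a (hd (filter P (ys @ c)))"
        by (rule Cons.IH[of "xs @ [y]"]) (use Cons.prems in auto)
      finally show ?thesis using False by simp
    qed simp
  qed
qed

lemma filter_eq_append_ConsD:
  assumes "filter P zs = us @ x # vs"
  shows "\<exists>xs ys. zs = xs @ x # ys \<and> P x \<and> vs = filter P ys"
  using assms
proof (induction us arbitrary: zs)
  case Nil
  then show ?case by (auto simp: filter_eq_Cons_iff)
next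
  case (Cons u us)
  then obtain xs ys where zs: "zs = xs @ u # ys" "filter P ys = us @ x # vs"
    by (auto simp: filter_eq_Cons_iff)
  from Cons.IH[OF zs(2)] show ?case
    unfolding zs(1) by (metis append_Cons append_assoc)
qed

text \<open>At an entry with \<open>P\<close>, \<open>w\<close> passes to the label of the
  successor, which is also the label of the next entry with \<open>P\<close>. To be applied with the
  breaks for \<open>P\<close>, the pushed elements for \<open>a\<close> and the associated
  permutation for \<open>w\<close>.\<close>

lemma map_eq_rotate1_filter:
  assumes cyc: "map f c = rotate1 c"
    and a: "\<And>x. x \<in> set c \<Longrightarrow> \<not> P x \<Longrightarrow> a (f x) = a x"
    and w: "\<And>x. x \<in> set c \<Longrightarrow> P x \<Longrightarrow> w (a x) = a (f x)"
  shows "map w (map a (filter P c)) = rotate1 (map a (filter P c))"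
proof (rule nth_equalityI)
  let ?us = "filter P c"
  fix i assume "i < length (map w (map a ?us))"
  then have i: "i < length ?us" by simp
  obtain xs ys where c: "c = xs @ ?us ! i # ys" and P: "P (?us ! i)"
    and ys: "drop (Suc i) ?us = filter P ys"
    using filter_eq_append_ConsD[OF id_take_nth_drop[OF i]] by blast
  have "w (a (?us ! i)) = a (hd (ys @ c))"
    using w[of "?us ! i"] P i map_eq_rotate1D[OF cyc c] nth_mem[OF i] by simp
  also have "\<dots> = a (hd (filter P (ys @ c)))"
  proof (rule map_eq_rotate1_skip[OF cyc])
    show "c = (xs @ [?us ! i]) @ ys" using c by simp
    show "\<exists>x\<in>set c. P x" using P nth_mem[OF i] by auto
  qed (use a in auto)
  also have "\<dots> = a (hd (drop (Suc i) ?us @ ?us))" by (simp add: ys)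
  also have "\<dots> = a (rotate1 ?us ! i)" by (simp add: hd_drop_Suc_eq_nth_rotate1[OF i])
  finally show "map w (map a ?us) ! i = rotate1 (map a ?us) ! i"
    using i by (simp add: rotate1_map)
qed simp

lemma cycle_decomposition_rotate1:
  assumes "cycle_decomposition X f bs" "b \<in> set bs"
  shows "map f b = rotate1 b"
  using assms by (intro nth_equalityI) (auto simp: cycle_decomposition_def nth_rotate1)

lemma map_product_of_cycles:
  assumes "distinct (concat as)" "a \<in> set as"
  shows "map (snd (product_of_cycles as)) a = rotate1 a"
  using assms
proof (induction as)
  case (Cons d as)
  have out: "snd (product_of_cycles as) x = x" if "x \<in> set d" for x
    by (rule permutes_not_in[OF product_of_cycles_permutes]) (use that Cons.prems in auto)
  have d: "map (cycle_of_list d) d = rotate1 d"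
    using cyclic_rotation[of d 1] Cons.prems by (simp add: rotate_def)
  show ?case
  proof (cases "a = d")
    case True
    have "map (snd (product_of_cycles (d # as))) d = map (cycle_of_list d) d"
      using out by simp
    with d True show ?thesis by metis
  next
    case False
    with Cons.prems have a: "a \<in> set as" by simp
    then have "set a \<inter> set d = {}" using Cons.prems by auto
    then have "map (cycle_of_list d) (rotate1 a) = rotate1 a"
      by (intro map_idI id_outside_supp) auto
    moreover have "map (snd (product_of_cycles as)) a = rotate1 a"
      using Cons.IH a Cons.prems by simp
    ultimately show ?thesis
      by (metis map_map product_of_cycles_Cons snd_conv)
  qed
qed simp

text \<open>Serves surjectivity below: an injective family of the right shape is a labelling of the
  breaks.\<close>

lemma ex_map_map_eq:
  assumes "map length xss = map length yss" "distinct (concat yss)"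
  shows "\<exists>g. xss = map (map g) yss"
proof -
  have len: "length (concat xss) = length (concat yss)"
    by (simp add: length_concat assms(1))
  define g where "g = (\<lambda>y. the (map_of (zip (concat yss) (concat xss)) y))"
  have "map g (concat yss) = concat xss"
    using assms(2) len by (intro nth_equalityI) (auto simp: g_def map_of_zip_nth)
  then have "concat (map (map g) yss) = concat xss" by (simp add: map_concat)
  then have "map (map g) yss = xss"
  proof (rule concat_injective)
    show "length (map (map g) yss) = length xss"
      using assms(1) by (metis length_map)
    show "\<forall>(x, y)\<in>set (zip (map (map g) yss) xss). length x = length y"
    proof clarify
      fix x y assume "(x, y) \<in> set (zip (map (map g) yss) xss)"
      then obtain i where "i < length yss" "i < length xss" "x = map g (yss ! i)" "y = xss ! i"
        by (auto simp: set_zip)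
      then show "length x = length y" using assms(1) by (metis length_map nth_map)
    qed
  qed
  then show ?thesis by metis
qed


section \<open>The location of a pushed element\<close>

lemma push_sigma_inj: "inj (push_sigma n p l)"
  by (rule permutes_inj[OF push_sigma_permutes[where X = UNIV]]) (simp add: UNIV_option_conv[symmetric])

lemma push_sigma_next_eq_push_elem:
  assumes "1 \<le> l" "l \<le> n" "p 1 = None"
  shows "push_sigma n p l (p (if l = n then 1 else l + 1)) = push_elem n p l"
  using push_sigma_next[of l n p] push_sigma_step[of l n p] assms by simp

text \<open>Step \<open>j\<close> exchanges the places \<open>push_elem n p j\<close> and
  \<open>None\<close>, occupied at that time by \<open>p j\<close> and its cyclic successor; by
  injectivity no other element moves.\<close>

lemma push_sigma_unmoved:
  assumes "1 \<le> l" "l \<le> r" "r \<le> n + 1" "p 1 = None"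
    and "\<And>j. l \<le> j \<Longrightarrow> j < r \<Longrightarrow> p j \<noteq> y \<and> p (if j = n then 1 else j + 1) \<noteq> y"
  shows "push_sigma n p l y = push_sigma n p r y"
  using assms(2,1,3,5)
proof (induction l rule: inc_induct)
  case (step l)
  have n: "l \<le> n" using step by simp
  have ne: "p l \<noteq> y" "p (if l = n then 1 else l + 1) \<noteq> y"
    using step by blast+
  have "push_sigma n p (l + 1) y \<noteq> push_elem n p l"
    using ne(1) injD[OF push_sigma_inj] unfolding push_elem_def by metis
  moreover have "push_sigma n p (l + 1) y \<noteq> None"
    using ne(2) injD[OF push_sigma_inj] push_sigma_next[of l n p] assms(4) step.prems n by metis
  ultimately have "push_sigma n p l y = push_sigma n p (l + 1) y"
    using n by (simp add: push_sigma_step[of l])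
  also have "\<dots> = push_sigma n p r y" using step by simp
  finally show ?case .
qed simp

text \<open>Time runs down, so step \<open>m\<close> is the first one to involve \<open>p m\<close>,
  which until then is at its initial place. The value \<open>None\<close> is excluded because step
  \<open>n\<close> involves it as the cyclic successor.\<close>

lemma push_elem_eq_last_occurrence:
  assumes "p 1 = None" "1 \<le> m" "m \<le> n" "p m \<noteq> None"
    and "\<And>j. m < j \<Longrightarrow> j \<le> n \<Longrightarrow> p j \<noteq> p m"
  shows "push_elem n p m = p m"
proof -
  have "push_sigma n p (m + 1) (p m) = push_sigma n p (n + 1) (p m)"
    using assms by (intro push_sigma_unmoved) auto
  then show ?thesis by (simp add: push_elem_def push_sigma_Suc)
qed

text \<open>
  The element that step \<open>m\<close> sends back to \<open>\<ast>\<close> is still in the place that it took in step \<open>f - 1\<close>.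
  The value \<open>f = n + 1\<close> covers the last occurrence of \<open>\<ast>\<close>, with \<open>1\<close> as its cyclic successor.
\<close>

lemma push_elem_eq_next_occurrence:
  assumes "p 1 = None" "1 \<le> m" "m + 1 < f" "f \<le> n + 1"
    and "p (if f = n + 1 then 1 else f) = p m"
    and "\<And>j. m < j \<Longrightarrow> j < f \<Longrightarrow> p j \<noteq> p m"
  shows "push_elem n p (f - 1) = push_elem n p m"
proof -
  have "(if f - 1 = n then 1 else f - 1 + 1) = (if f = n + 1 then 1 else f)"
    using assms(2,3) by auto
  then have "push_elem n p (f - 1) = push_sigma n p (f - 1) (p m)"
    using push_sigma_next_eq_push_elem[of "f - 1" n p] assms(1-5) by simp
  also have "\<dots> = push_sigma n p (m + 1) (p m)"
    using assms by (intro push_sigma_unmoved[symmetric]) auto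
  finally show ?thesis by (simp add: push_elem_def)
qed

text \<open>The last step in time to involve \<open>p f\<close> is step \<open>f - 1\<close>, which
  takes it from \<open>None\<close> to \<open>push_elem n p (f - 1)\<close>.\<close>

lemma push_sigma_first_occurrence:
  assumes "p 1 = None" "1 < f" "f \<le> n"
    and "\<And>j. 1 \<le> j \<Longrightarrow> j < f \<Longrightarrow> p j \<noteq> p f"
  shows "push_sigma n p 1 (p f) = push_elem n p (f - 1)"
proof -
  have "push_sigma n p 1 (p f) = push_sigma n p (f - 1) (p f)"
    using assms by (intro push_sigma_unmoved) auto
  also have "\<dots> = push_elem n p (f - 1)"
  proof -
    have "(if f - 1 = n then 1 else f - 1 + 1) = f" using assms(2,3) by auto
    then show ?thesis
      using push_sigma_next_eq_push_elem[of "f - 1" n p] assms(1-3) by simp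
  qed
  finally show ?thesis .
qed


section \<open>The fat partition\<close>

definition same_block :: "nat set set \<Rightarrow> nat \<Rightarrow> nat \<Rightarrow> bool" where
  "same_block \<pi> l m \<longleftrightarrow> (\<exists>B\<in>\<pi>. l \<in> B \<and> m \<in> B)"

lemma same_pattern_iff:
  "same_pattern n p \<pi> \<Longrightarrow> l \<in> {1..n} \<Longrightarrow> m \<in> {1..n} \<Longrightarrow> p l = p m \<longleftrightarrow> same_block \<pi> l m"
  by (simp add: same_pattern_def same_block_def)

text \<open>The inequality holds exactly at the largest element of a block, where \<open>fat\<close>
  returns the smallest one; this is 1 exactly when the block contains 1.\<close>

definition fat_break :: "nat set set \<Rightarrow> nat \<Rightarrow> bool" where
  "fat_break \<pi> m \<longleftrightarrow> fat \<pi> m \<le> m \<and> fat \<pi> m \<noteq> 1"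

locale interval_partition =
  fixes n :: nat and \<pi> :: "nat set set"
  assumes part: "partition_on {1..n} \<pi>" and n: "n \<ge> 1"
begin

lemma same_block_sym: "same_block \<pi> l m \<Longrightarrow> same_block \<pi> m l"
  by (auto simp: same_block_def)

lemma same_block_refl: "l \<in> {1..n} \<Longrightarrow> same_block \<pi> l l"
  using part by (auto simp: same_block_def partition_on_def)

lemma same_block_trans: "same_block \<pi> k l \<Longrightarrow> same_block \<pi> l m \<Longrightarrow> same_block \<pi> k m"
  using part unfolding same_block_def partition_on_def disjoint_def by blast

lemma same_block_range: "same_block \<pi> l m \<Longrightarrow> m \<in> {1..n}"
  using part by (auto simp: same_block_def partition_on_def)

text \<open>The description operator and \<open>Min\<close> are dealt with here once and for all;
  later arguments about \<open>fat\<close> rest on these facts alone.\<close>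

lemma fat_spec:
  assumes "x \<in> {1..n}"
  shows same_block_fat: "same_block \<pi> x (fat \<pi> x)"
    and fat_between: "x < j \<Longrightarrow> j < fat \<pi> x \<Longrightarrow> \<not> same_block \<pi> x j"
    and fat_wrap: "fat \<pi> x \<le> x \<Longrightarrow> same_block \<pi> x j \<Longrightarrow> fat \<pi> x \<le> j \<and> j \<le> x"
proof -
  obtain B where B: "B \<in> \<pi>" "x \<in> B"
    using same_block_refl[OF assms] by (auto simp: same_block_def)
  have uniq: "C \<in> \<pi> \<and> x \<in> C \<longleftrightarrow> C = B" for C
    using disjointD[OF partition_onD2[OF part] _ B(1)] B by auto
  then have the: "(THE B. B \<in> \<pi> \<and> x \<in> B) = B" by simp
  have sb: "same_block \<pi> x j \<longleftrightarrow> j \<in> B" for j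
    using uniq B unfolding same_block_def by metis
  have fin: "finite B"
    using part B(1) by (intro finite_subset[of B "{1..n}"]) (auto simp: partition_on_def)
  have fat: "fat \<pi> x = (if \<exists>y\<in>B. x < y then Min {y\<in>B. x < y} else Min B)"
    by (simp add: fat_def the)
  show "same_block \<pi> x (fat \<pi> x)"
  proof (cases "\<exists>y\<in>B. x < y")
    case True
    have "Min {y\<in>B. x < y} \<in> {y\<in>B. x < y}" by (rule Min_in) (use fin True in auto)
    with True show ?thesis by (simp add: fat sb)
  next
    case False
    have "Min B \<in> B" by (rule Min_in) (use fin B in auto)
    with False show ?thesis by (simp add: fat sb)
  qed
  show "\<not> same_block \<pi> x j" if "x < j" "j < fat \<pi> x"
  proof
    assume "same_block \<pi> x j"
    then have "j \<in> {y\<in>B. x < y}" using that sb by simp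
    then have "fat \<pi> x \<le> j" using fin by (auto simp: fat intro!: Min_le)
    with that show False by simp
  qed
  show "fat \<pi> x \<le> j \<and> j \<le> x" if "fat \<pi> x \<le> x" "same_block \<pi> x j"
  proof (cases "\<exists>y\<in>B. x < y")
    case True
    have "Min {y\<in>B. x < y} \<in> {y\<in>B. x < y}" by (rule Min_in) (use fin True in auto)
    then show ?thesis using True that(1) by (simp add: fat)
  next
    case False
    then show ?thesis using that fin sb by (auto simp: fat not_less)
  qed
qed

lemma fat_range: "x \<in> {1..n} \<Longrightarrow> fat \<pi> x \<in> {1..n}"
  by (rule same_block_range[OF same_block_fat])

lemma fat_wrap_unique:
  assumes "x \<in> {1..n}" "y \<in> {1..n}" "same_block \<pi> x y" "fat \<pi> x \<le> x" "fat \<pi> y \<le> y"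
  shows "x = y"
  using fat_wrap[OF assms(1,4,3)] fat_wrap[OF assms(2,5) same_block_sym[OF assms(3)]] by simp

lemma fat_eq_1_unique:
  assumes "x \<in> {1..n}" "y \<in> {1..n}" "fat \<pi> x = 1" "fat \<pi> y = 1"
  shows "x = y"
proof (rule fat_wrap_unique[OF assms(1,2)])
  show "same_block \<pi> x y"
    using same_block_fat[OF assms(1)] same_block_fat[OF assms(2)] assms(3,4)
    by (metis same_block_sym same_block_trans)
qed (use assms in auto)

lemma cmap_range: "x \<in> {1..n} \<Longrightarrow> cmap n x \<in> {1..n}"
  by (auto simp: cmap_def)

lemma cmap_inj: "inj_on (cmap n) {1..n}"
  by (auto simp: cmap_def inj_on_def split: if_splits)

text \<open>A representative of each block. In a block without 1 it is the only break, so labelling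
  the breaks amounts to labelling these blocks.\<close>

definition block_max :: "nat \<Rightarrow> nat" where
  "block_max l = Max {j. same_block \<pi> l j}"

lemma block_max:
  assumes "l \<in> {1..n}"
  shows "same_block \<pi> l (block_max l)" "block_max l \<in> {1..n}" "fat \<pi> (block_max l) \<le> block_max l"
proof -
  have fin: "finite {j. same_block \<pi> l j}"
    by (rule finite_subset[of _ "{1..n}"]) (use same_block_range in auto)
  have "block_max l \<in> {j. same_block \<pi> l j}"
    unfolding block_max_def by (rule Max_in[OF fin]) (use same_block_refl[OF assms] in auto)
  then show 1: "same_block \<pi> l (block_max l)" by simp
  then show 2: "block_max l \<in> {1..n}" by (rule same_block_range)
  show "fat \<pi> (block_max l) \<le> block_max l"
    using Max_ge[OF fin] same_block_trans[OF 1 same_block_fat[OF 2]]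
    by (simp add: block_max_def)
qed

lemma block_max_break:
  assumes "l \<in> {1..n}" "\<not> same_block \<pi> 1 l"
  shows "fat_break \<pi> (block_max l)"
  using block_max[OF assms(1)] same_block_fat[of "block_max l"] assms(2)
    same_block_trans[of l "block_max l" 1] same_block_sym[of l 1] by (auto simp: fat_break_def)

lemma block_max_eq_iff:
  assumes "l \<in> {1..n}" "m \<in> {1..n}"
  shows "block_max l = block_max m \<longleftrightarrow> same_block \<pi> l m"
proof
  assume "block_max l = block_max m"
  then show "same_block \<pi> l m"
    using block_max(1)[OF assms(1)] block_max(1)[OF assms(2)] same_block_sym same_block_trans
    by metis
next
  assume "same_block \<pi> l m"
  then have "same_block \<pi> l j \<longleftrightarrow> same_block \<pi> m j" for j
    using same_block_sym same_block_trans by blast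
  then show "block_max l = block_max m" by (simp add: block_max_def)
qed

lemma block_max_of_break:
  assumes "m \<in> {1..n}" "fat_break \<pi> m"
  shows "block_max m = m"
  using fat_wrap_unique[OF block_max(2)[OF assms(1)] assms(1) same_block_sym] block_max[OF assms(1)]
    assms(2) by (simp add: fat_break_def)

lemma break_not_same_block_1:
  assumes "m \<in> {1..n}" "fat_break \<pi> m"
  shows "\<not> same_block \<pi> 1 m"
proof
  assume "same_block \<pi> 1 m"
  then have "fat \<pi> m \<le> 1"
    using fat_wrap[of m 1] same_block_sym[of 1 m] assms by (simp add: fat_break_def)
  then show False using fat_range[OF assms(1)] assms by (auto simp: fat_break_def)
qed

section \<open>Pushing sequences with pattern \<open>\<pi>\<close>\<close>

lemma same_pattern_not_None:
  assumes "same_pattern n p \<pi>" "p 1 = None" "l \<in> {1..n}"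
  shows "p l = None \<longleftrightarrow> same_block \<pi> 1 l"
  using same_pattern_iff[OF assms(1), of 1 l] assms n by auto

text \<open>\<open>cmap n x\<close> is the cyclic predecessor of \<open>x\<close>; a fixed point
  puts both into one block, so two adjacent entries of \<open>p\<close> would coincide.\<close>

lemma fixpoint_not_pushing:
  assumes "x \<in> {1..n}" "fat \<pi> (cmap n x) = x"
  shows "\<not> (pushing A n p \<and> same_pattern n p \<pi>)"
proof
  assume p: "pushing A n p \<and> same_pattern n p \<pi>"
  have c: "cmap n x \<in> {1..n}" by (rule cmap_range[OF assms(1)])
  have "p (cmap n x) = p x"
    using same_pattern_iff[of n p \<pi>, OF _ c assms(1)] same_block_fat[OF c] assms p by simp
  moreover have "p (cmap n x) \<noteq> p (if cmap n x = n then 1 else cmap n x + 1)"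
    using p c by (auto simp: pushing_def)
  moreover have "(if cmap n x = n then 1 else cmap n x + 1) = x"
    using assms(1) by (auto simp: cmap_def)
  ultimately show False by simp
qed

text \<open>If adjacent entries were equal, their indices would share a block, and
  \<open>fat\<close> would take the first index to the second: nothing lies in between or, at
  \<open>n\<close>, 1 is the smallest element of the block. The second index would be a fixed
  point.\<close>

lemma pushing_if_no_fixpoint:
  assumes nofix: "\<And>x. x \<in> {1..n} \<Longrightarrow> fat \<pi> (cmap n x) \<noteq> x"
    and p: "p \<in> {1..n} \<rightarrow>\<^sub>E insert None (Some ` A)" "p 1 = None" "same_pattern n p \<pi>"
  shows "pushing A n p"
  unfolding pushing_def
proof (intro conjI ballI p(1,2))
  fix l assume l: "l \<in> {1..n}"
  show "p l \<noteq> p (if l = n then 1 else l + 1)"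
  proof (cases "l = n")
    case True
    have "fat \<pi> n = 1" if "same_block \<pi> n 1"
      using fat_wrap[of n 1] fat_range[of n] that n by fastforce
    then show ?thesis
      using True nofix[of 1] n same_pattern_iff[OF p(3), of n 1] by (auto simp: cmap_def)
  next
    case False
    then have l1: "l + 1 \<in> {1..n}" using l by simp
    have "fat \<pi> l = l + 1" if "same_block \<pi> l (l + 1)"
    proof -
      have "\<not> fat \<pi> l \<le> l" using fat_wrap[OF l _ that] by auto
      moreover have "\<not> l + 1 < fat \<pi> l" using fat_between[OF l, of "l + 1"] that by auto
      ultimately show ?thesis by simp
    qed
    then show ?thesis
      using False nofix[OF l1] l same_pattern_iff[OF p(3) l l1] by (auto simp: cmap_def)
  qed
qed


section \<open>Pushed elements at breaks and elsewhere\<close>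

context
  fixes A :: "'a set" and p :: "nat \<Rightarrow> 'a option"
  assumes push: "pushing A n p" and pattern: "same_pattern n p \<pi>"
begin

lemma p_1: "p 1 = None"
  using push by (simp add: pushing_def)

lemmas p_eq_iff = same_pattern_iff[OF pattern]

text \<open>A break is the last occurrence of a label other than \<open>None\<close>.\<close>

lemma push_elem_break:
  assumes "m \<in> {1..n}" "fat_break \<pi> m"
  shows "push_elem n p m = p m"
proof (rule push_elem_eq_last_occurrence[where p = p, OF p_1])
  show "p m \<noteq> None"
    using same_pattern_not_None[OF pattern p_1 assms(1)] break_not_same_block_1[OF assms] by simp
  fix j assume "m < j" "j \<le> n"
  then show "p j \<noteq> p m"
    using p_eq_iff[of m j] fat_wrap[OF assms(1), of j] assms by (auto simp: fat_break_def)
qed (use assms in auto)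

lemma push_elem_non_break:
  assumes m: "m \<in> {1..n}" and "\<not> fat_break \<pi> m"
  shows "push_elem n p (cmap n (fat \<pi> m)) = push_elem n p m"
proof (cases "fat \<pi> m \<le> m")
  case True
  with assms have 1: "fat \<pi> m = 1" by (simp add: fat_break_def)
  have pm: "p m = None"
    using p_eq_iff[of m 1] same_block_fat[OF m] 1 p_1 m n by simp
  \<comment> \<open>The lemma on the next occurrence needs \<open>m + 1 < f\<close>, here with
    \<open>f = n + 1\<close>; the cyclic pushing condition at \<open>n\<close> provides it.\<close>
  have "m \<noteq> n"
  proof
    assume "m = n"
    moreover have "p n \<noteq> p (if n = n then 1 else n + 1)"
      using push n unfolding pushing_def by (metis atLeastAtMost_iff order_refl)
    ultimately show False using pm p_1 by simp
  qed
  have "push_elem n p (n + 1 - 1) = push_elem n p m"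
  proof (rule push_elem_eq_next_occurrence)
    show "p j \<noteq> p m" if "m < j" "j < n + 1" for j
      using fat_wrap[OF m True, of j] p_eq_iff[OF m, of j] that by auto
  qed (use m pm p_1 \<open>m \<noteq> n\<close> in auto)
  then show ?thesis by (simp add: 1 cmap_def)
next
  case False
  have f: "fat \<pi> m \<in> {1..n}" by (rule fat_range[OF m])
  have eq: "p (fat \<pi> m) = p m"
    using p_eq_iff[OF m f] same_block_fat[OF m] by simp
  have "p m \<noteq> p (if m = n then 1 else m + 1)"
    using push m by (auto simp: pushing_def)
  \<comment> \<open>Again for the strict inequality \<open>m + 1 < f\<close>, now with
    \<open>f = fat \<pi> m\<close>.\<close>
  then have "fat \<pi> m \<noteq> m + 1" using eq f by (auto split: if_splits)
  have "push_elem n p (fat \<pi> m - 1) = push_elem n p m"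
  proof (rule push_elem_eq_next_occurrence)
    show "p j \<noteq> p m" if "m < j" "j < fat \<pi> m" for j
      using fat_between[OF m that] p_eq_iff[OF m, of j] that f by auto
  qed (use m f eq p_1 False \<open>fat \<pi> m \<noteq> m + 1\<close> in auto)
  then show ?thesis using False m by (simp add: cmap_def)
qed

text \<open>At a break \<open>fat\<close> wraps to the first occurrence of the label, and the label
  itself is \<open>push_elem n p m\<close>.\<close>

lemma push_sigma_break:
  assumes m: "m \<in> {1..n}" and br: "fat_break \<pi> m"
  shows "push_sigma n p 1 (push_elem n p m) = push_elem n p (cmap n (fat \<pi> m))"
proof -
  have f: "fat \<pi> m \<in> {1..n}" by (rule fat_range[OF m])
  have eq: "p (fat \<pi> m) = p m"
    using p_eq_iff[OF m f] same_block_fat[OF m] by simp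
  have "push_sigma n p 1 (p (fat \<pi> m)) = push_elem n p (fat \<pi> m - 1)"
  proof (rule push_sigma_first_occurrence[where p = p, OF p_1])
    fix j assume j: "1 \<le> j" "j < fat \<pi> m"
    then have "j \<in> {1..n}" using f by auto
    then show "p j \<noteq> p (fat \<pi> m)"
      using p_eq_iff[OF m, of j] fat_wrap[OF m, of j] br j eq by (auto simp: fat_break_def)
  qed (use f br in \<open>auto simp: fat_break_def\<close>)
  then show ?thesis using br eq push_elem_break[OF m br] by (simp add: cmap_def fat_break_def)
qed

end


section \<open>Families indexed by the breaks\<close>

context
  fixes bs :: "nat list list"
  assumes dec: "cycle_decomposition {1..n} (fat \<pi> \<circ> cmap n) bs"
begin

text \<open>Applying \<open>cmap n\<close> conjugates a cycle of
  \<open>fat \<pi> \<circ> cmap n\<close> to one of \<open>cmap n \<circ> fat \<pi>\<close>, along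
  which the pushed elements are followed. The order of the breaks is kept because it becomes the
  order in the cycle of the associated permutation.\<close>

definition break_lists :: "nat list list" where
  "break_lists = map (\<lambda>b. filter (fat_break \<pi>) (map (cmap n) b)) bs"

lemma set_concat_bs: "set (concat bs) = {1..n}" and distinct_bs: "distinct (concat bs)"
  using dec by (auto simp: cycle_decomposition_def)

lemma concat_break_lists: "concat break_lists = filter (fat_break \<pi>) (map (cmap n) (concat bs))"
  by (simp add: break_lists_def filter_concat map_concat comp_def)

lemma distinct_break_lists: "distinct (concat break_lists)"
  unfolding concat_break_lists
  by (intro distinct_filter) (use cmap_inj in \<open>simp add: distinct_map distinct_bs set_concat_bs del: set_concat\<close>)

lemma cmap_image: "cmap n ` {1..n} = {1..n}"
  by (rule endo_inj_surj) (use cmap_range cmap_inj in auto)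

lemma set_break_lists: "set (concat break_lists) = {m \<in> {1..n}. fat_break \<pi> m}"
  unfolding concat_break_lists using cmap_image set_concat_bs by (auto simp del: set_concat)

lemma length_break_list:
  assumes b: "b \<in> set bs"
  shows "length (filter (fat_break \<pi>) (map (cmap n) b)) = length b - clockwise_winds b"
proof -
  let ?f = "fat \<pi> \<circ> cmap n"
  have rot: "map ?f b = rotate1 b" by (rule cycle_decomposition_rotate1[OF dec b])
  have sub: "set b \<subseteq> {1..n}" using b set_concat_bs by auto
  have dist: "distinct b" using b distinct_bs by (simp add: distinct_concat_iff)
  \<comment> \<open>\<open>M\<close> consists of the \<open>x\<close> for which
    \<open>cmap n x\<close> is the largest element of its block. Removing the preimage of 1 leaves
    the breaks; removing 1 leaves the counterclockwise steps.\<close>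
  define M where "M = {x \<in> set b. ?f x \<le> cmap n x}"
  have "length (filter (fat_break \<pi>) (map (cmap n) b)) = card {x \<in> set b. fat_break \<pi> (cmap n x)}"
    using dist by (simp add: filter_map distinct_length_filter comp_def Int_def conj_commute)
  also have "{x \<in> set b. fat_break \<pi> (cmap n x)} = M - {x \<in> set b. ?f x = 1}"
    by (auto simp: M_def fat_break_def)
  \<comment> \<open>If 1 is on the cycle, its unique preimage and 1 itself both lie in
    \<open>M\<close>; otherwise neither removal has an effect.\<close>
  also have "card \<dots> = card (M - {1})"
  proof (cases "1 \<in> set b")
    case True
    then obtain x where x: "x \<in> set b" "?f x = 1"
      using map_eq_rotate1_image[OF rot] by (metis imageE)
    have "y = x" if "y \<in> set b" "?f y = 1" for y
    proof -
      have "cmap n y = cmap n x"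
        by (rule fat_eq_1_unique) (use that x sub cmap_range in auto)
      then show ?thesis using cmap_inj that x sub by (auto dest: inj_onD)
    qed
    then have "{x \<in> set b. ?f x = 1} = {x}" using x by blast
    moreover have "x \<in> M" using x sub cmap_range[of x] by (auto simp: M_def)
    moreover have "1 \<in> M"
      using True fat_range[of n] n by (auto simp: M_def cmap_def)
    ultimately show ?thesis by (simp only: card_Diff_singleton)
  next
    case False
    have "{x \<in> set b. ?f x = 1} = {}"
      using False map_eq_rotate1_image[OF rot] by (metis (mono_tags, lifting) empty_Collect_eq imageI)
    moreover have "1 \<notin> M" using False by (simp add: M_def)
    ultimately show ?thesis by (metis Diff_empty Diff_insert0)
  qed
  \<comment> \<open>For \<open>x\<close> other than 1, \<open>cmap n x\<close> is
    \<open>x - 1\<close>, so the weak inequality becomes a strict one against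
    \<open>x\<close>.\<close>
  also have "M - {1} = {x \<in> set b. x > ?f x}"
    using sub by (auto simp: M_def cmap_def subset_iff split: if_splits) (use fat_range[of n] n in auto)
  also have "card \<dots> = card {i. i < length b \<and> b ! i > ?f (b ! i)}"
  proof -
    have "{x \<in> set b. x > ?f x} = (\<lambda>i. b ! i) ` {i. i < length b \<and> b ! i > ?f (b ! i)}"
      by (auto simp: in_set_conv_nth)
    moreover have "inj_on (\<lambda>i. b ! i) {i. i < length b \<and> b ! i > ?f (b ! i)}"
      using dist by (auto simp: inj_on_def nth_eq_iff_index_eq)
    ultimately show ?thesis by (simp only: card_image)
  qed
  also have "{i. i < length b \<and> b ! i > ?f (b ! i)}
      = {..<length b} - {i. i < length b \<and> b ! i \<le> b ! ((i + 1) mod length b)}"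
    using dec b by (auto simp: cycle_decomposition_def)
  also have "card \<dots> = length b - clockwise_winds b"
    by (subst card_Diff_subset) (auto simp: clockwise_winds_def)
  finally show ?thesis .
qed

lemma map_length_break_lists:
  "map length break_lists = map (\<lambda>b. length b - clockwise_winds b) bs"
  unfolding break_lists_def map_map comp_def
  by (rule map_cong) (simp_all only: length_break_list)

text \<open>A cycle without breaks consists of clockwise winds only, so its maximum is mapped to
  itself. Conversely, a fixed point is a cycle of length 1 with one wind, hence without
  breaks.\<close>

lemma no_break_iff_fixpoint:
  "[] \<in> set break_lists \<longleftrightarrow> (\<exists>x\<in>{1..n}. fat \<pi> (cmap n x) = x)"
proof
  assume "[] \<in> set break_lists"
  then obtain b where b: "b \<in> set bs" "filter (fat_break \<pi>) (map (cmap n) b) = []"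
    by (auto simp: break_lists_def)
  have bne: "b \<noteq> []" and sub: "set b \<subseteq> {1..n}"
    using dec b set_concat_bs by (auto simp: cycle_decomposition_def)
  have "card {i. i < length b \<and> b ! i \<le> b ! ((i + 1) mod length b)} \<le> card {..<length b}"
    by (rule card_mono) auto
  moreover have "length b \<le> clockwise_winds b"
    using length_break_list[OF b(1)] b(2) by simp
  ultimately have "{i. i < length b \<and> b ! i \<le> b ! ((i + 1) mod length b)} = {..<length b}"
    by (intro card_subset_eq) (auto simp: clockwise_winds_def)
  then have asc: "b ! i \<le> fat \<pi> (cmap n (b ! i))" if "i < length b" for i
    using dec b that by (auto simp: cycle_decomposition_def)
  define x where "x = Max (set b)"
  have x: "x \<in> set b" using bne by (simp add: x_def)
  then have "fat \<pi> (cmap n x) \<in> set b"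
    using map_eq_rotate1_image[OF cycle_decomposition_rotate1[OF dec b(1)]] by auto
  then have "fat \<pi> (cmap n x) \<le> x" by (simp add: x_def)
  moreover have "x \<le> fat \<pi> (cmap n x)" using asc x by (auto simp: in_set_conv_nth)
  ultimately show "\<exists>x\<in>{1..n}. fat \<pi> (cmap n x) = x" using x sub by fastforce
next
  assume "\<exists>x\<in>{1..n}. fat \<pi> (cmap n x) = x"
  then obtain x where x: "x \<in> {1..n}" "fat \<pi> (cmap n x) = x" by blast
  then have "x \<in> set (concat bs)" by (simp only: set_concat_bs)
  then obtain b where b: "b \<in> set bs" "x \<in> set b" by auto
  then obtain i where i: "i < length b" "b ! i = x" by (auto simp: in_set_conv_nth)
  have dist: "distinct b" using b distinct_bs by (simp add: distinct_concat_iff)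
  have "b ! ((i + 1) mod length b) = b ! i"
    using dec b i x by (auto simp: cycle_decomposition_def)
  then have "(i + 1) mod length b = i"
    using dist i by (metis mod_less_divisor nth_eq_iff_index_eq gr_implies_not0 neq0_conv)
  then have "length b = 1" using i by (cases "i + 1 = length b") auto
  then have "b = [x]" using b(2) by (cases b) auto
  then have "{i. i < length b \<and> b ! i \<le> b ! ((i + 1) mod length b)} = {0}" by auto
  then have "clockwise_winds b = 1" by (simp add: clockwise_winds_def)
  then have "length (filter (fat_break \<pi>) (map (cmap n) b)) = 0"
    using length_break_list[OF b(1)] \<open>length b = 1\<close> by simp
  then show "[] \<in> set break_lists" using b(1) by (force simp: break_lists_def)
qed

text \<open>Both permutations rotate each row and fix everything off the rows. The supports agree
  because each pushed element equals the label of the next break on its cycle.\<close>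

lemma assoc_pperm_eq_product_of_cycles:
  assumes push: "pushing A n p" and pattern: "same_pattern n p \<pi>"
    and ne: "[] \<notin> set break_lists"
  shows "distinct (concat (map (map (the \<circ> p)) break_lists))"
    and "assoc_pperm A n p = product_of_cycles (map (map (the \<circ> p)) break_lists)"
proof -
  let ?as = "map (map (the \<circ> p)) break_lists"
  note p1 = p_1[OF push pattern]
  let ?D = "{m \<in> {1..n}. fat_break \<pi> m}"
  let ?a = "\<lambda>l. the (push_elem n p l)"
  have conc: "concat ?as = map (the \<circ> p) (concat break_lists)" by (simp add: map_concat)
  \<comment> \<open>Breaks avoid the block of 1, so \<open>the\<close> loses nothing there.\<close>
  have some: "Some (the (p m)) = p m" if "m \<in> ?D" for m
    using same_pattern_not_None[OF pattern p1, of m] break_not_same_block_1[of m] that by auto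
  have "inj_on (the \<circ> p) ?D"
  proof (rule inj_onI)
    fix l m assume lm: "l \<in> ?D" "m \<in> ?D" "(the \<circ> p) l = (the \<circ> p) m"
    then have "p l = p m" using some[of l] some[of m] by (metis comp_apply)
    then have "same_block \<pi> l m" using same_pattern_iff[OF pattern] lm by simp
    then show "l = m" using fat_wrap_unique lm by (simp add: fat_break_def)
  qed
  then show distinct: "distinct (concat ?as)"
    unfolding conc by (simp only: distinct_map distinct_break_lists set_break_lists)
  have a_some: "Some (?a l) = push_elem n p l" if "l \<in> {1..n}" for l
    using push_elem_not_None[OF push that] by simp
  obtain d w where dw: "assoc_pperm A n p = (d, w)" by (cases "assoc_pperm A n p")
  have d: "d = {x. Some x \<in> push_elem n p ` {1..n}}"
    and w: "w = restrict_perm A (\<lambda>x. the (push_sigma n p 1 (Some x)))"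
    using dw by (auto simp: assoc_pperm_def)
  have inA: "(d, w) \<in> pperms A" using assoc_pperm_in[OF push] dw by simp
  have d_image: "d = ?a ` {1..n}"
  proof (intro equalityI subsetI)
    fix x assume "x \<in> d"
    then obtain l where "l \<in> {1..n}" "Some x = push_elem n p l" unfolding d by blast
    then show "x \<in> ?a ` {1..n}" by (metis imageI option.sel)
  qed (use a_some in \<open>auto simp: d\<close>)
  have range: "set (map (cmap n) b) \<subseteq> {1..n}" if "b \<in> set bs" for b
  proof -
    have "set b \<subseteq> {1..n}" using that set_concat_bs by auto
    then show ?thesis using cmap_image by auto
  qed
  have as: "?as = map (\<lambda>b. map ?a (filter (fat_break \<pi>) (map (cmap n) b))) bs"
  proof -
    have "map (the \<circ> p) (filter (fat_break \<pi>) (map (cmap n) b))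
        = map ?a (filter (fat_break \<pi>) (map (cmap n) b))" if "b \<in> set bs" for b
    proof (rule map_cong[OF refl])
      fix m assume "m \<in> set (filter (fat_break \<pi>) (map (cmap n) b))"
      then have "m \<in> {1..n}" "fat_break \<pi> m" using range[OF that] by auto
      then show "(the \<circ> p) m = ?a m" using push_elem_break[OF push pattern] by simp
    qed
    then show ?thesis by (simp add: break_lists_def comp_def)
  qed
  have cyc: "map (cmap n \<circ> fat \<pi>) (map (cmap n) b) = rotate1 (map (cmap n) b)" if "b \<in> set bs" for b
    using cycle_decomposition_rotate1[OF dec that]
    by (metis (no_types, lifting) comp_assoc map_map rotate1_map)
  have const: "?a ((cmap n \<circ> fat \<pi>) m) = ?a m" if "m \<in> {1..n}" "\<not> fat_break \<pi> m" for m
    using push_elem_non_break[OF push pattern that] by simp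
  have move: "w (?a m) = ?a ((cmap n \<circ> fat \<pi>) m)" if "m \<in> {1..n}" "fat_break \<pi> m" for m
  proof -
    have "?a m \<in> A" using inA d_image that(1) by (auto simp: pperms_def)
    then show ?thesis
      using push_sigma_break[OF push pattern that] a_some[OF that(1)]
      by (simp add: w restrict_perm_def)
  qed
  have rot: "map w a = rotate1 a" if a: "a \<in> set ?as" for a
  proof -
    obtain b where b: "b \<in> set bs" "a = map ?a (filter (fat_break \<pi>) (map (cmap n) b))"
      using a unfolding as set_map by blast
    show ?thesis unfolding b(2)
      by (rule map_eq_rotate1_filter[OF cyc[OF b(1)]]) (use const move range[OF b(1)] in auto)
  qed
  have "?a l \<in> set (concat ?as)" if l: "l \<in> {1..n}" for l
  proof -
    obtain x where "x \<in> set (concat bs)" and "l = cmap n x"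
      using l cmap_image unfolding set_concat_bs by blast
    then obtain b where b: "b \<in> set bs" "l \<in> set (map (cmap n) b)" by auto
    let ?c = "map (cmap n) b"
    obtain xs ys where xs: "?c = xs @ l # ys" using split_list[OF b(2)] by blast
    have "filter (fat_break \<pi>) ?c \<noteq> []" using ne b(1) unfolding break_lists_def set_map by (metis imageI)
    then have ne': "\<exists>x\<in>set ?c. fat_break \<pi> x" by (auto simp: filter_empty_conv)
    \<comment> \<open>The first break met from \<open>l\<close> on, counting \<open>l\<close>
      itself; \<open>ne\<close> ensures that there is one.\<close>
    define h where "h = hd (filter (fat_break \<pi>) ((l # ys) @ ?c))"
    have "?a (hd ((l # ys) @ ?c)) = ?a h"
      unfolding h_def
      by (rule map_eq_rotate1_skip[OF cyc[OF b(1)] _ ne' xs]) (use const range[OF b(1)] in auto)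
    then have "?a l = ?a h" by (simp only: append_Cons list.sel)
    moreover have "h \<in> set (filter (fat_break \<pi>) ((l # ys) @ ?c))"
      unfolding h_def by (rule hd_in_set) (use ne' in \<open>auto simp: filter_empty_conv\<close>)
    then have "h \<in> set (filter (fat_break \<pi>) ?c)"
      using b(2) xs by auto
    ultimately show ?thesis unfolding as using b(1) by auto
  qed
  moreover have "set (concat ?as) \<subseteq> d"
  proof
    fix x assume "x \<in> set (concat ?as)"
    then obtain m where m: "m \<in> ?D" "x = the (p m)"
      unfolding conc set_map set_break_lists by auto
    then have "?a m = x" using push_elem_break[OF push pattern, of m] by simp
    then show "x \<in> d" using m(1) unfolding d_image by blast
  qed
  ultimately have d_eq: "d = set (concat ?as)" unfolding d_image by blast
  have "w x = snd (product_of_cycles ?as) x" for x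
  proof (cases "x \<in> d")
    case True
    then obtain a where a: "a \<in> set ?as" "x \<in> set a" unfolding d_eq set_concat by blast
    have "map w a = map (snd (product_of_cycles ?as)) a"
      using rot[OF a(1)] map_product_of_cycles[OF distinct a(1)] by simp
    then show ?thesis using a(2) by simp
  next
    case False
    then have "w x = x" using inA by (cases "x \<in> A") (auto simp: pperms_def permutes_def)
    then show ?thesis
      using False permutes_not_in[OF product_of_cycles_permutes, of x ?as] d_eq by simp
  qed
  then show "assoc_pperm A n p = product_of_cycles ?as"
    unfolding dw using d_eq by (intro prod_eqI) (auto simp: fst_product_of_cycles)
qed

text \<open>A sequence with pattern \<open>\<pi>\<close> is \<open>None\<close> on the block of 1
  and constant on every other block, so its labels at the breaks determine it. Since
  \<open>ne\<close> rules out fixed points, any distinct labels yield a pushing sequence.\<close>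

lemma bij_betw_pushing_inj_families:
  assumes ne: "[] \<notin> set break_lists"
  shows "bij_betw (\<lambda>p. map (map (the \<circ> p)) break_lists)
    {p. pushing A n p \<and> same_pattern n p \<pi>} (inj_families A (map length break_lists))"
  unfolding bij_betw_def
proof (intro conjI equalityI subsetI inj_onI)
  let ?D = "{m \<in> {1..n}. fat_break \<pi> m}"
  {
    fix p p' :: "nat \<Rightarrow> 'a option"
    assume p: "p \<in> {p. pushing A n p \<and> same_pattern n p \<pi>}"
      and p': "p' \<in> {p. pushing A n p \<and> same_pattern n p \<pi>}"
      and eq: "map (map (the \<circ> p)) break_lists = map (map (the \<circ> p')) break_lists"
    have P: "p l = (if same_block \<pi> 1 l then None else Some (the (p (block_max l))))"
      if "l \<in> {1..n}" "pushing A n p" "same_pattern n p \<pi>" for l and p :: "nat \<Rightarrow> 'a option"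
    proof -
      have "p l = p (block_max l)"
        using same_pattern_iff[OF that(3)] block_max(1,2)[OF that(1)] that(1) by simp
      then show ?thesis
        using same_pattern_not_None[OF that(3) p_1[OF that(2,3)] that(1)] by auto
    qed
    have "map (the \<circ> p) (concat break_lists) = map (the \<circ> p') (concat break_lists)"
      using arg_cong[OF eq, of concat] by (simp only: map_concat)
    then have D: "the (p m) = the (p' m)" if "m \<in> ?D" for m
      using that set_break_lists by (auto simp del: set_concat)
    show "p = p'"
    proof
      fix l
      show "p l = p' l"
      proof (cases "l \<in> {1..n}")
        case True
        have "the (p (block_max l)) = the (p' (block_max l))" if "\<not> same_block \<pi> 1 l"
          using D block_max_break[OF True that] block_max(2)[OF True] by simp
        then show ?thesis using P[OF True, of p] P[OF True, of p'] p p' by auto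
      next
        case False
        then show ?thesis using p p' by (auto simp: pushing_def PiE_def extensional_def)
      qed
    qed
  next
    fix as assume "as \<in> (\<lambda>p. map (map (the \<circ> p)) break_lists) ` {p. pushing A n p \<and> same_pattern n p \<pi>}"
    then obtain p where as: "as = map (map (the \<circ> p)) break_lists"
      and p: "pushing A n p" "same_pattern n p \<pi>" by auto
    have "set (concat as) \<subseteq> A"
      using assoc_pperm_in[OF p(1)] fst_product_of_cycles[of as]
      unfolding assoc_pperm_eq_product_of_cycles(2)[OF p ne, folded as]
      by (auto simp: pperms_def simp del: set_concat)
    then show "as \<in> inj_families A (map length break_lists)"
      using assoc_pperm_eq_product_of_cycles(1)[OF p ne, folded as] by (simp add: inj_families_def as comp_def)
  next
    fix as assume as: "as \<in> inj_families A (map length break_lists)"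
    then obtain g where g: "as = map (map g) break_lists"
      using ex_map_map_eq[OF _ distinct_break_lists, of as] by (auto simp: inj_families_def)
    have conc: "concat as = map g (concat break_lists)" by (simp add: g map_concat)
    have gA: "g ` ?D \<subseteq> A" and inj: "inj_on g ?D"
      using as unfolding inj_families_def mem_Collect_eq conc set_map distinct_map set_break_lists
      by auto
    \<comment> \<open>The inverse construction: each index off the block of 1 gets the label of the
      break in its block. The extensional function space requires \<open>undefined\<close> outside
      \<open>{1..n}\<close>.\<close>
    define p where "p = (\<lambda>l. if l \<in> {1..n} then
        if same_block \<pi> 1 l then None else Some (g (block_max l)) else undefined)"
    have D: "block_max l \<in> ?D" if "l \<in> {1..n}" "\<not> same_block \<pi> 1 l" for l
      using block_max_break[OF that] block_max(2)[OF that(1)] by simp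
    have PiE: "p \<in> {1..n} \<rightarrow>\<^sub>E insert None (Some ` A)"
    proof (rule PiE_I)
      fix l assume l: "l \<in> {1..n}"
      show "p l \<in> insert None (Some ` A)"
        using l gA D[OF l] by (cases "same_block \<pi> 1 l") (auto simp: p_def)
    qed (auto simp: p_def)
    have p1: "p 1 = None" using same_block_refl[of 1] n by (simp add: p_def)
    have pat: "same_pattern n p \<pi>"
      unfolding same_pattern_def same_block_def[symmetric]
    proof (intro ballI)
      fix l m assume lm: "l \<in> {1..n}" "m \<in> {1..n}"
      show "p l = p m \<longleftrightarrow> same_block \<pi> l m"
      proof (cases "same_block \<pi> 1 l \<or> same_block \<pi> 1 m")
        case True
        then have "p l = p m \<longleftrightarrow> same_block \<pi> 1 l \<and> same_block \<pi> 1 m"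
          using lm by (auto simp: p_def)
        then show ?thesis using True by (metis same_block_sym same_block_trans)
      next
        case False
        then have "p l = p m \<longleftrightarrow> block_max l = block_max m"
          using lm D inj by (auto simp: p_def inj_on_eq_iff)
        then show ?thesis by (simp add: block_max_eq_iff[OF lm])
      qed
    qed
    have "pushing A n p"
      by (rule pushing_if_no_fixpoint[OF _ PiE p1 pat]) (use ne no_break_iff_fixpoint in auto)
    moreover have "as = map (map (the \<circ> p)) break_lists"
    proof -
      have "the (p m) = g m" if "m \<in> ?D" for m
        using that break_not_same_block_1[of m] block_max_of_break[of m] by (simp add: p_def)
      then have "\<forall>bl\<in>set break_lists. \<forall>m\<in>set bl. the (p m) = g m"
        using set_break_lists by auto
      then show ?thesis by (simp add: g)
    qed
    ultimately show "as \<in> (\<lambda>p. map (map (the \<circ> p)) break_lists) ` {p. pushing A n p \<and> same_pattern n p \<pi>}"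
      using pat by blast
  }
qed

lemma Phi_alg_eq_Sigma_alg:
  "Phi_alg A n \<pi> = Sigma_alg A (map (\<lambda>b. length b - clockwise_winds b) bs)"
proof (cases "[] \<in> set break_lists")
  case True
  \<comment> \<open>A cycle without breaks makes both sides 0: there is no pushing sequence to sum
    over, and 0 occurs among the lengths.\<close>
  then obtain x where "x \<in> {1..n}" "fat \<pi> (cmap n x) = x"
    using no_break_iff_fixpoint by blast
  then have "{p. pushing A n p \<and> same_pattern n p \<pi>} = {}"
    using fixpoint_not_pushing by blast
  moreover have "0 \<in> set (map length break_lists)" using True by force
  ultimately show ?thesis
    unfolding Phi_alg_def Sigma_alg_def map_length_break_lists[symmetric]
    by (simp only: sum.empty if_True)
next
  case False
  then have "0 \<notin> set (map length break_lists)" by auto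
  then have "Sigma_alg A (map length break_lists) = (\<Sum>as\<in>inj_families A (map length break_lists).
      Poly_Mapping.single (product_of_cycles as) 1)"
    by (simp add: Sigma_alg_def)
  also have "\<dots> = (\<Sum>p | pushing A n p \<and> same_pattern n p \<pi>.
      Poly_Mapping.single (product_of_cycles (map (map (the \<circ> p)) break_lists)) 1)"
    by (rule sum.reindex_bij_betw[OF bij_betw_pushing_inj_families[OF False], symmetric])
  also have "\<dots> = Phi_alg A n \<pi>"
    unfolding Phi_alg_def
    by (rule sum.cong) (simp_all add: assoc_pperm_eq_product_of_cycles(2)[OF _ _ False])
  finally show ?thesis by (simp add: map_length_break_lists)
qed

end

end

theorem theorem5p7:
  fixes n :: nat and \<pi> :: "nat set set" and bs :: "nat list list"
  assumes "n \<ge> 1"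
    and "partition_on {1..n} \<pi>"
    and "cycle_decomposition {1..n} (fat \<pi> \<circ> cmap n) bs"
  shows "Phi_inf n \<pi> = Sigma_inf (map (\<lambda>b. length b - clockwise_winds b) bs)"
proof -
  interpret interval_partition n \<pi> by unfold_locales (fact assms)+
  \<comment> \<open>Equality in the projective limit is equality of all components, so the identity
    over each \<open>{1..q}\<close> suffices.\<close>
  show ?thesis
    by (simp add: component_inject[symmetric] Phi_inf.rep_eq Sigma_inf.rep_eq
        Phi_alg_eq_Sigma_alg[OF assms(3)])
qed

end
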